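(* Let $\Gamma$ be a countable graph. Then there exist $2^{\aleph_0}$ pairwise non-isomorphic countable algebraically closed graphs whose automorphism group is isomorphic to $\operatorname{Aut}\Gamma$.
   Context: A graph is a pair $(V,E)$ with $V$ a non-empty set and $E$ an irreflexive symmetric binary relation on $V$ (undirected, no loops or multiple edges). A graph is algebraically closed if for every finite set $A$ of vertices there is a vertex adjacent to every vertex of $A$. *)

theory Defs
  imports "HOL-Algebra.Bij" "HOL-Library.Countable_Set" "HOL-Library.Equipollence"
begin

type_synonym 'a ugraph = "'a set \<times> ('a \<times> 'a) set"

abbreviation verts :: "'a ugraph \<Rightarrow> 'a set" where
  "verts \<equiv> fst"

abbreviation edges :: "'a ugraph \<Rightarrow> ('a \<times> 'a) set" where
  "edges \<equiv> snd"

definition is_graph :: "'a ugraph \<Rightarrow> bool" where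
  "is_graph G \<longleftrightarrow>
     verts G \<noteq> {} \<and> edges G \<subseteq> verts G \<times> verts G \<and> irrefl (edges G) \<and> sym (edges G)"

definition countable_graph :: "'a ugraph \<Rightarrow> bool" where
  "countable_graph G \<longleftrightarrow> is_graph G \<and> countable (verts G)"

definition algebraically_closed :: "'a ugraph \<Rightarrow> bool" where
  "algebraically_closed G \<longleftrightarrow>
     (\<forall>A. finite A \<and> A \<subseteq> verts G \<longrightarrow> (\<exists>v\<in>verts G. \<forall>a\<in>A. (v, a) \<in> edges G))"

definition graph_isomorphism :: "'a ugraph \<Rightarrow> 'b ugraph \<Rightarrow> ('a \<Rightarrow> 'b) \<Rightarrow> bool" where
  "graph_isomorphism G H f \<longleftrightarrow>
     bij_betw f (verts G) (verts H) \<and>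
     (\<forall>u\<in>verts G. \<forall>v\<in>verts G. (u, v) \<in> edges G \<longleftrightarrow> (f u, f v) \<in> edges H)"

definition graph_isomorphic :: "'a ugraph \<Rightarrow> 'b ugraph \<Rightarrow> bool" where
  "graph_isomorphic G H \<longleftrightarrow> (\<exists>f. graph_isomorphism G H f)"

text \<open>Automorphisms are represented by maps that are \<^const>\<open>undefined\<close> outside the vertex
  set (the convention of \<^const>\<open>Bij\<close>), so that each automorphism is counted once.\<close>

definition graph_Aut :: "'a ugraph \<Rightarrow> ('a \<Rightarrow> 'a) monoid" where
  "graph_Aut G =
     BijGroup (verts G) \<lparr>carrier := {f \<in> Bij (verts G). graph_isomorphism G G f}\<rparr>"

lemma group_graph_Aut: "group (graph_Aut G)"
proof -
  interpret group "BijGroup (verts G)" by (rule group_BijGroup)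
  have "subgroup {f \<in> Bij (verts G). graph_isomorphism G G f} (BijGroup (verts G))"
  proof (rule subgroupI)
    show "{f \<in> Bij (verts G). graph_isomorphism G G f} \<subseteq> carrier (BijGroup (verts G))"
      by (auto simp: BijGroup_def)
    have "(\<lambda>x\<in>verts G. x) \<in> {f \<in> Bij (verts G). graph_isomorphism G G f}"
      using id_Bij[of "verts G"] by (auto simp: graph_isomorphism_def Bij_def)
    then show "{f \<in> Bij (verts G). graph_isomorphism G G f} \<noteq> {}" by blast
  next
    fix f assume f: "f \<in> {f \<in> Bij (verts G). graph_isomorphism G G f}"
    then have fB: "f \<in> Bij (verts G)" and fi: "graph_isomorphism G G f" by auto
    have bij: "bij_betw f (verts G) (verts G)" using fB by (simp add: Bij_def)
    let ?g = "\<lambda>x\<in>verts G. inv_into (verts G) f x"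
    have gB: "?g \<in> Bij (verts G)" using fB by (rule restrict_inv_into_Bij)
    have mem: "inv_into (verts G) f x \<in> verts G" "f (inv_into (verts G) f x) = x"
      if "x \<in> verts G" for x
      using bij that by (auto simp: bij_betw_def inv_into_into f_inv_into_f)
    have "graph_isomorphism G G ?g"
      using gB fi mem by (simp add: graph_isomorphism_def Bij_def)
    then show "inv\<^bsub>BijGroup (verts G)\<^esub> f \<in> {f \<in> Bij (verts G). graph_isomorphism G G f}"
      using gB fB by (simp add: inv_BijGroup)
  next
    fix f g assume f: "f \<in> {f \<in> Bij (verts G). graph_isomorphism G G f}"
      and g: "g \<in> {f \<in> Bij (verts G). graph_isomorphism G G f}"
    then have "compose (verts G) f g \<in> Bij (verts G)" by (simp add: compose_Bij)
    moreover have "g x \<in> verts G" if "x \<in> verts G" for x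
      using g that by (auto simp: Bij_def bij_betw_def)
    ultimately show "f \<otimes>\<^bsub>BijGroup (verts G)\<^esub> g \<in> {f \<in> Bij (verts G). graph_isomorphism G G f}"
      using f g by (simp add: BijGroup_def graph_isomorphism_def Bij_def compose_eq)
  qed
  then show ?thesis unfolding graph_Aut_def by (rule subgroup_imp_group)
qed

end

theory Submission
  imports Defs
begin

text \<open>Passing to the complement preserves the automorphism group, and a graph or its complement is
  connected, so \<open>\<Gamma>\<close> may be assumed connected. Its disjoint sum with a connected, locally finite,
  infinite rigid graph not isomorphic to \<open>\<Gamma>\<close> has automorphism group \<open>Aut \<Gamma>\<close>, and no finite set of
  vertices dominates this sum, which means that its complement is algebraically closed. The rigid
  summands are rays \<open>0, 1, 2, \<dots>\<close> with additional edges that code a subset \<open>S\<close> of the natural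
  numbers: \<open>i \<in> S\<close> iff \<open>3i + 1, 3i + 2, 3i + 3\<close> is a triangle.\<close>

section \<open>Isomorphisms and automorphism groups\<close>

lemma graph_isomorphism_sym:
  assumes "graph_isomorphism G H f"
  shows "graph_isomorphism H G (inv_into (verts G) f)"
proof -
  have b: "bij_betw f (verts G) (verts H)"
    using assms by (simp add: graph_isomorphism_def)
  have "inv_into (verts G) f y \<in> verts G" "f (inv_into (verts G) f y) = y" if "y \<in> verts H" for y
    using b that by (auto simp: bij_betw_def inv_into_into f_inv_into_f)
  then show ?thesis
    using assms bij_betw_inv_into[OF b] by (simp add: graph_isomorphism_def)
qed

lemma graph_isomorphism_trans:
  assumes "graph_isomorphism G H f" "graph_isomorphism H K g"
  shows "graph_isomorphism G K (g \<circ> f)"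
  using assms bij_betw_trans[of f "verts G" "verts H" g "verts K"]
  by (auto simp: graph_isomorphism_def dest: bij_betwE)

lemma graph_isomorphic_refl: "graph_isomorphic G G"
  unfolding graph_isomorphic_def graph_isomorphism_def by (rule exI[of _ id]) auto

lemma graph_isomorphic_sym: "graph_isomorphic G H \<Longrightarrow> graph_isomorphic H G"
  unfolding graph_isomorphic_def using graph_isomorphism_sym by blast

lemma graph_isomorphic_trans:
  "graph_isomorphic G H \<Longrightarrow> graph_isomorphic H K \<Longrightarrow> graph_isomorphic G K"
  unfolding graph_isomorphic_def using graph_isomorphism_trans by blast

text \<open>Later shows that an isomorphism sends a connected summand into a single summand.
  \<open>is_graph G\<close> keeps the points of a walk among the vertices, where \<open>f\<close>
  respects adjacency.\<close>

lemma graph_isomorphism_rtrancl: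
  assumes f: "graph_isomorphism G H f" and G: "is_graph G" and "(x, y) \<in> (edges G)\<^sup>*"
  shows "(f x, f y) \<in> (edges H)\<^sup>*"
  using assms(3)
proof induction
  case (step y z)
  moreover have "y \<in> verts G" "z \<in> verts G"
    using step G by (auto simp: is_graph_def)
  ultimately show ?case
    using f by (meson graph_isomorphism_def rtrancl.rtrancl_into_rtrancl)
qed simp

lemma carrier_graph_Aut:
  "f \<in> carrier (graph_Aut G) \<longleftrightarrow> f \<in> extensional (verts G) \<and> graph_isomorphism G G f"
  by (auto simp: graph_Aut_def Bij_def graph_isomorphism_def)

lemma mult_graph_Aut:
  assumes "f \<in> carrier (graph_Aut G)" "g \<in> carrier (graph_Aut G)"
  shows "f \<otimes>\<^bsub>graph_Aut G\<^esub> g = compose (verts G) f g"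
  using assms by (simp add: graph_Aut_def BijGroup_def)

text \<open>Every automorphism of \<open>H\<close> maps the copy of \<open>G\<close> onto itself because it fixes
  all other vertices; taking \<open>h\<close> surjective gives invariance under isomorphism.\<close>

lemma graph_Aut_iso_of_embedding:
  assumes inj: "inj_on h (verts G)" and sub: "h ` verts G \<subseteq> verts H"
    and edge: "\<And>u v. u \<in> verts G \<Longrightarrow> v \<in> verts G \<Longrightarrow> (u, v) \<in> edges G \<longleftrightarrow> (h u, h v) \<in> edges H"
    and sep: "\<And>u y. u \<in> verts G \<Longrightarrow> y \<in> verts H - h ` verts G \<Longrightarrow>
                (h u, y) \<notin> edges H \<and> (y, h u) \<notin> edges H"
    and fixed: "\<And>f y. graph_isomorphism H H f \<Longrightarrow> y \<in> verts H - h ` verts G \<Longrightarrow> f y = y"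
  shows "graph_Aut H \<cong> graph_Aut G"
proof -
  let ?k = "inv_into (verts G) h"
  \<comment> \<open>Conjugation by the embedding. It makes sense once \<open>f\<close> is known to
    preserve the copy of \<open>G\<close>, and it will be the group isomorphism.\<close>
  define \<theta> where "\<theta> f = (\<lambda>x\<in>verts G. ?k (f (h x)))" for f
  have kh: "?k (h x) = x" if "x \<in> verts G" for x
    using inj that by simp
  \<comment> \<open>If \<open>f (h x)\<close> lay outside the copy, it would be fixed by
    \<open>f\<close>; injectivity would give \<open>f (h x) = h x\<close>, a point of the
    copy.\<close>
  have ex: "\<exists>x'\<in>verts G. f (h x) = h x'" if f: "graph_isomorphism H H f" and x: "x \<in> verts G" for f x
  proof (rule ccontr)
    assume "\<not> (\<exists>x'\<in>verts G. f (h x) = h x')"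
    moreover have b: "bij_betw f (verts H) (verts H)" using f by (simp add: graph_isomorphism_def)
    moreover have hx: "h x \<in> verts H" using sub x by auto
    ultimately have out: "f (h x) \<in> verts H - h ` verts G" by (auto dest: bij_betwE)
    then have "f (f (h x)) = f (h x)" using fixed f by blast
    then have "f (h x) = h x" using b hx out by (auto simp: bij_betw_def dest: inj_onD)
    with out x show False by auto
  qed
  have \<theta>: "\<theta> f x \<in> verts G" "h (\<theta> f x) = f (h x)"
    if "graph_isomorphism H H f" "x \<in> verts G" for f x
    using ex[OF that] that kh by (auto simp: \<theta>_def)
  \<comment> \<open>A point outside the copy is its own image, so only points of the copy reach the
    copy. This makes \<open>\<theta> f\<close> surjective.\<close>
  have surjh: "y \<in> h ` verts G"
    if f: "graph_isomorphism H H f" and "y \<in> verts H" "f y \<in> h ` verts G" for f y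
    using that fixed[OF f, of y] by (cases "y \<in> h ` verts G") auto
  have car: "\<theta> f \<in> carrier (graph_Aut G)" if "f \<in> carrier (graph_Aut H)" for f
  proof -
    have f: "graph_isomorphism H H f" using that by (simp add: carrier_graph_Aut)
    then have b: "bij_betw f (verts H) (verts H)" by (simp add: graph_isomorphism_def)
    have "inj_on (\<theta> f) (verts G)"
    proof (rule inj_onI)
      fix x y assume xy: "x \<in> verts G" "y \<in> verts G" "\<theta> f x = \<theta> f y"
      then have "f (h x) = f (h y)" using \<theta>(2)[OF f] by metis
      then have "h x = h y" using b xy sub by (metis bij_betw_def image_subset_iff inj_on_eq_iff)
      then show "x = y" using xy inj by (auto dest: inj_onD)
    qed
    moreover have "\<theta> f ` verts G = verts G"
    proof
      show "\<theta> f ` verts G \<subseteq> verts G" using \<theta>(1)[OF f] by auto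
      show "verts G \<subseteq> \<theta> f ` verts G"
      proof
        fix z assume z: "z \<in> verts G"
        then obtain y where y: "y \<in> verts H" "f y = h z"
          using b sub by (metis bij_betw_imp_surj_on image_eqI image_iff subset_iff)
        then obtain x where x: "x \<in> verts G" "y = h x" using surjh[OF f y(1)] z by auto
        then have "\<theta> f x = z" using y z kh by (simp add: \<theta>_def)
        then show "z \<in> \<theta> f ` verts G" using x by auto
      qed
    qed
    moreover have "(u, v) \<in> edges G \<longleftrightarrow> (\<theta> f u, \<theta> f v) \<in> edges G"
      if uv: "u \<in> verts G" "v \<in> verts G" for u v
    proof -
      have "(u, v) \<in> edges G \<longleftrightarrow> (h u, h v) \<in> edges H" using edge uv by simp
      also have "\<dots> \<longleftrightarrow> (f (h u), f (h v)) \<in> edges H"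
        using f uv sub by (auto simp: graph_isomorphism_def)
      also have "\<dots> \<longleftrightarrow> (\<theta> f u, \<theta> f v) \<in> edges G"
        using edge[of "\<theta> f u" "\<theta> f v"] \<theta>[OF f] uv by simp
      finally show ?thesis .
    qed
    ultimately show ?thesis
      by (auto simp: carrier_graph_Aut graph_isomorphism_def bij_betw_def \<theta>_def)
  qed
  have "\<theta> \<in> hom (graph_Aut H) (graph_Aut G)"
  proof (rule homI)
    fix f g assume fg: "f \<in> carrier (graph_Aut H)" "g \<in> carrier (graph_Aut H)"
    then have g: "graph_isomorphism H H g" by (simp add: carrier_graph_Aut)
    have "\<theta> (compose (verts H) f g) = compose (verts G) (\<theta> f) (\<theta> g)"
    proof
      fix x
      show "\<theta> (compose (verts H) f g) x = compose (verts G) (\<theta> f) (\<theta> g) x"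
      proof (cases "x \<in> verts G")
        case True
        then have "h x \<in> verts H" using sub by auto
        then have "\<theta> (compose (verts H) f g) x = ?k (f (g (h x)))"
          using True by (simp add: \<theta>_def compose_def)
        also have "\<dots> = ?k (f (h (\<theta> g x)))" using \<theta>(2)[OF g True] by simp
        also have "\<dots> = \<theta> f (\<theta> g x)" using \<theta>(1)[OF g True] by (simp add: \<theta>_def[of f])
        finally show ?thesis using True by (simp add: compose_def)
      qed (simp add: \<theta>_def compose_def)
    qed
    then show "\<theta> (f \<otimes>\<^bsub>graph_Aut H\<^esub> g) = \<theta> f \<otimes>\<^bsub>graph_Aut G\<^esub> \<theta> g"
      using fg car by (simp add: mult_graph_Aut)
  qed (rule car)
  moreover have "inj_on \<theta> (carrier (graph_Aut H))"
  proof (rule inj_onI)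
    fix f g assume "f \<in> carrier (graph_Aut H)" "g \<in> carrier (graph_Aut H)" and eq: "\<theta> f = \<theta> g"
    then have f: "graph_isomorphism H H f" "f \<in> extensional (verts H)"
      and g: "graph_isomorphism H H g" "g \<in> extensional (verts H)"
      by (simp_all add: carrier_graph_Aut)
    show "f = g"
    proof (rule extensionalityI[OF f(2) g(2)])
      fix y assume y: "y \<in> verts H"
      show "f y = g y"
      proof (cases "y \<in> h ` verts G")
        case True
        then obtain x where "x \<in> verts G" "y = h x" by auto
        then show ?thesis using \<theta>(2)[OF f(1)] \<theta>(2)[OF g(1)] eq by metis
      next
        case False
        then show ?thesis using fixed[OF f(1)] fixed[OF g(1)] y by simp
      qed
    qed
  qed
  moreover have "\<exists>f\<in>carrier (graph_Aut H). \<theta> f = \<phi>" if "\<phi> \<in> carrier (graph_Aut G)" for \<phi>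
  proof -
    have \<phi>: "graph_isomorphism G G \<phi>" "\<phi> \<in> extensional (verts G)"
      using that by (simp_all add: carrier_graph_Aut)
    then have b: "bij_betw \<phi> (verts G) (verts G)" by (simp add: graph_isomorphism_def)
    then have mem: "\<phi> x \<in> verts G" if "x \<in> verts G" for x using that by (auto dest: bij_betwE)
    \<comment> \<open>The preimage of \<open>\<phi>\<close> under \<open>\<theta>\<close>: act by
      \<open>\<phi>\<close> on the copy and trivially elsewhere.\<close>
    define f where "f = (\<lambda>y\<in>verts H. if y \<in> h ` verts G then h (\<phi> (?k y)) else y)"
    have fh: "f (h x) = h (\<phi> x)" if "x \<in> verts G" for x
      using that sub kh by (auto simp: f_def)
    have fo: "f y = y" if "y \<in> verts H" "y \<notin> h ` verts G" for y
      using that by (simp add: f_def)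
    have "bij_betw h (verts G) (h ` verts G)" using inj by (simp add: bij_betw_def)
    then have "bij_betw (h \<circ> \<phi> \<circ> ?k) (h ` verts G) (h ` verts G)"
      using b by (meson bij_betw_inv_into bij_betw_trans)
    then have 1: "bij_betw f (h ` verts G) (h ` verts G)"
      by (rule bij_betw_cong[THEN iffD1, rotated]) (use fh kh in auto)
    have 2: "bij_betw f (verts H - h ` verts G) (verts H - h ` verts G)"
      by (rule bij_betw_cong[THEN iffD1, OF _ bij_betw_id]) (use fo in auto)
    have "bij_betw f (h ` verts G \<union> (verts H - h ` verts G)) (h ` verts G \<union> (verts H - h ` verts G))"
      by (rule bij_betw_combine[OF 1 2]) auto
    then have "bij_betw f (verts H) (verts H)"
      using sub by (simp add: Un_absorb1)
    moreover have "(u, v) \<in> edges H \<longleftrightarrow> (f u, f v) \<in> edges H"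
      if "u \<in> verts H" "v \<in> verts H" for u v
    proof -
      \<comment> \<open>In the mixed cases \<open>f\<close> keeps each point on its side of the
        copy, so \<open>sep\<close> excludes adjacency both before and after applying
        \<open>f\<close>.\<close>
      consider (ii) x y where "x \<in> verts G" "y \<in> verts G" "u = h x" "v = h y"
        | (io) x where "x \<in> verts G" "u = h x" "v \<notin> h ` verts G"
        | (oi) y where "y \<in> verts G" "v = h y" "u \<notin> h ` verts G"
        | (oo) "u \<notin> h ` verts G" "v \<notin> h ` verts G"
        by blast
      then show ?thesis
      proof cases
        case ii
        then have "(x, y) \<in> edges G \<longleftrightarrow> (\<phi> x, \<phi> y) \<in> edges G"
          using \<phi>(1) by (auto simp: graph_isomorphism_def)
        then show ?thesis using ii edge mem fh by simp
      next
        case io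
        then show ?thesis using sep[of x v] sep[of "\<phi> x" v] that fh fo mem by simp
      next
        case oi
        then show ?thesis using sep[of y u] sep[of "\<phi> y" u] that fh fo mem by simp
      next
        case oo
        then show ?thesis using that fo by simp
      qed
    qed
    ultimately have "f \<in> carrier (graph_Aut H)"
      by (auto simp: carrier_graph_Aut graph_isomorphism_def f_def)
    moreover have "\<theta> f = \<phi>"
    proof (rule extensionalityI[OF _ \<phi>(2)])
      show "\<theta> f \<in> extensional (verts G)" by (simp add: \<theta>_def)
      show "\<theta> f x = \<phi> x" if "x \<in> verts G" for x
        using that fh kh mem by (simp add: \<theta>_def)
    qed
    ultimately show ?thesis by blast
  qed
  ultimately have "\<theta> \<in> iso (graph_Aut H) (graph_Aut G)"
    using car by (fastforce simp: iso_def bij_betw_def)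
  then show ?thesis by (auto simp: is_iso_def)
qed

section \<open>Complements and connectedness\<close>

definition complement_graph :: "'a ugraph \<Rightarrow> 'a ugraph" where
  "complement_graph G =
     (verts G, {(x, y). x \<in> verts G \<and> y \<in> verts G \<and> x \<noteq> y \<and> (x, y) \<notin> edges G})"

lemma verts_complement_graph [simp]: "verts (complement_graph G) = verts G"
  by (simp add: complement_graph_def)

lemma edges_complement_graph:
  "(x, y) \<in> edges (complement_graph G) \<longleftrightarrow>
     x \<in> verts G \<and> y \<in> verts G \<and> x \<noteq> y \<and> (x, y) \<notin> edges G"
  by (simp add: complement_graph_def)

lemma is_graph_complement: "is_graph G \<Longrightarrow> is_graph (complement_graph G)"
  by (auto simp: is_graph_def complement_graph_def irrefl_def sym_def)

text \<open>A bijection preserves distinctness, so adjacency of distinct vertices may be negated on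
  both sides; irreflexivity settles equal vertices.\<close>

lemma graph_isomorphism_complement:
  assumes "is_graph G" "is_graph H"
  shows "graph_isomorphism (complement_graph G) (complement_graph H) f \<longleftrightarrow> graph_isomorphism G H f"
proof (cases "bij_betw f (verts G) (verts H)")
  case True
  have "((u, v) \<in> edges (complement_graph G) \<longleftrightarrow> (f u, f v) \<in> edges (complement_graph H))
      \<longleftrightarrow> ((u, v) \<in> edges G \<longleftrightarrow> (f u, f v) \<in> edges H)"
    if uv: "u \<in> verts G" "v \<in> verts G" for u v
  proof -
    have "f u \<in> verts H" "f v \<in> verts H" "f u = f v \<longleftrightarrow> u = v"
      using True uv by (auto simp: bij_betw_def inj_on_eq_iff)
    moreover have "(u, u) \<notin> edges G" "(f u, f u) \<notin> edges H"
      using assms by (auto simp: is_graph_def irrefl_def)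
    ultimately show ?thesis using uv by (auto simp: edges_complement_graph)
  qed
  then show ?thesis using True by (simp add: graph_isomorphism_def)
qed (simp add: graph_isomorphism_def)

lemma graph_Aut_complement: "is_graph G \<Longrightarrow> graph_Aut (complement_graph G) = graph_Aut G"
  by (simp add: graph_Aut_def graph_isomorphism_complement)

definition connected_graph :: "'a ugraph \<Rightarrow> bool" where
  "connected_graph G \<longleftrightarrow> verts G \<times> verts G \<subseteq> (edges G)\<^sup>*"

text \<open>Let \<open>u\<close>, \<open>v\<close> lie in different components of the complement, so
  that they are adjacent in \<open>G\<close>. A vertex \<open>w\<close> unreachable from
  \<open>u\<close> in \<open>G\<close> is then unreachable from \<open>v\<close> too, and
  \<open>u\<close>, \<open>w\<close>, \<open>v\<close> is a walk in the complement, a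
  contradiction.\<close>

lemma connected_or_complement_connected:
  assumes G: "is_graph G"
  shows "connected_graph G \<or> connected_graph (complement_graph G)"
proof (rule disjCI)
  let ?E = "(edges G)\<^sup>*" and ?C = "edges (complement_graph G)"
  assume "\<not> connected_graph (complement_graph G)"
  then obtain u v where uv: "u \<in> verts G" "v \<in> verts G" "(u, v) \<notin> ?C\<^sup>*"
    by (auto simp: connected_graph_def)
  have symE: "(y, x) \<in> ?E" if "(x, y) \<in> ?E" for x y
    using that G sym_rtrancl[of "edges G"] by (auto simp: is_graph_def dest: symD)
  have uvE: "(u, v) \<in> edges G"
    using uv by (metis edges_complement_graph r_into_rtrancl rtrancl.rtrancl_refl)
  have reach: "(u, w) \<in> ?E" if w: "w \<in> verts G" for w
  proof (rule ccontr)
    assume no: "(u, w) \<notin> ?E"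
    then have "w \<noteq> u" "(u, w) \<notin> edges G" by auto
    then have "(u, w) \<in> ?C" using w uv by (simp add: edges_complement_graph)
    moreover have "(v, w) \<notin> ?E" using no uvE by (meson converse_rtrancl_into_rtrancl)
    then have "(w, v) \<notin> ?E" using symE by blast
    then have "w \<noteq> v" "(w, v) \<notin> edges G" by auto
    then have "(w, v) \<in> ?C" using w uv by (simp add: edges_complement_graph)
    ultimately show False using uv(3) by (meson r_into_rtrancl rtrancl_into_rtrancl)
  qed
  then show "connected_graph G"
    using symE by (auto simp: connected_graph_def intro: rtrancl_trans)
qed

section \<open>Transport along bijections, needed to place the graphs on the natural numbers\<close>

definition image_graph :: "('a \<Rightarrow> 'b) \<Rightarrow> 'a ugraph \<Rightarrow> 'b ugraph" where
  "image_graph h G = (h ` verts G, map_prod h h ` edges G)"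

lemma graph_isomorphism_image:
  assumes "is_graph G" "inj_on h (verts G)"
  shows "graph_isomorphism G (image_graph h G) h"
proof -
  have "(u, v) \<in> edges G \<longleftrightarrow> (h u, h v) \<in> map_prod h h ` edges G"
    if uv: "u \<in> verts G" "v \<in> verts G" for u v
  proof
    assume "(h u, h v) \<in> map_prod h h ` edges G"
    then obtain x y where xy: "(x, y) \<in> edges G" "h x = h u" "h y = h v" by auto
    moreover have "x \<in> verts G" "y \<in> verts G" using xy assms by (auto simp: is_graph_def)
    ultimately show "(u, v) \<in> edges G" using uv assms(2) by (auto dest: inj_onD)
  qed (auto intro: rev_image_eqI)
  then show ?thesis using assms(2) by (simp add: graph_isomorphism_def image_graph_def bij_betw_def)
qed

lemma is_graph_image:
  assumes "is_graph G" "inj_on h (verts G)"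
  shows "is_graph (image_graph h G)"
  using assms inj_onD[OF assms(2)]
  by (fastforce simp: is_graph_def image_graph_def irrefl_def sym_def)

lemma algebraically_closed_isomorphic:
  assumes f: "graph_isomorphism G H f" and G: "algebraically_closed G"
  shows "algebraically_closed H"
  unfolding algebraically_closed_def
proof (intro allI impI)
  fix A assume A: "finite A \<and> A \<subseteq> verts H"
  have b: "bij_betw f (verts G) (verts H)" using f by (simp add: graph_isomorphism_def)
  with A obtain B where B: "B \<subseteq> verts G" "finite B" "A = f ` B"
    by (metis bij_betw_imp_surj_on finite_subset_image)
  with G obtain v where "v \<in> verts G" "\<forall>a\<in>B. (v, a) \<in> edges G"
    unfolding algebraically_closed_def by blast
  then have "f v \<in> verts H" "\<forall>a\<in>A. (f v, a) \<in> edges H"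
    using f b B by (auto simp: graph_isomorphism_def dest: bij_betwE)
  then show "\<exists>v\<in>verts H. \<forall>a\<in>A. (v, a) \<in> edges H" by blast
qed

text \<open>Nothing lies outside the image of \<open>f\<close>, so the conditions \<open>sep\<close>
  and \<open>fixed\<close> hold vacuously.\<close>

lemma graph_Aut_isomorphic:
  assumes "graph_isomorphism G H f"
  shows "graph_Aut H \<cong> graph_Aut G"
  using assms
  by (intro graph_Aut_iso_of_embedding[where h = f]) (auto simp: graph_isomorphism_def bij_betw_def)

section \<open>Rigid rays coding sets of natural numbers\<close>

text \<open>The offsets keep different triangles disjoint and leave \<open>0\<close> outside all of
  them, so \<open>0\<close> has the single neighbour \<open>1\<close> while every other vertex has
  at least two.\<close>

definition triangle_ray :: "nat set \<Rightarrow> nat ugraph" where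
  "triangle_ray S = (UNIV, {(m, n). n = Suc m \<or> m = Suc n \<or>
     (\<exists>i\<in>S. m = 3 * i + 1 \<and> n = 3 * i + 3 \<or> m = 3 * i + 3 \<and> n = 3 * i + 1)})"

lemma verts_triangle_ray [simp]: "verts (triangle_ray S) = UNIV"
  by (simp add: triangle_ray_def)

lemma edges_triangle_ray:
  "(m, n) \<in> edges (triangle_ray S) \<longleftrightarrow> n = Suc m \<or> m = Suc n \<or>
     (\<exists>i\<in>S. m = 3 * i + 1 \<and> n = 3 * i + 3 \<or> m = 3 * i + 3 \<and> n = 3 * i + 1)"
  by (simp add: triangle_ray_def)

lemma is_graph_triangle_ray: "is_graph (triangle_ray S)"
  by (auto simp: is_graph_def irrefl_def edges_triangle_ray intro!: symI)

lemma connected_triangle_ray: "connected_graph (triangle_ray S)"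
proof -
  let ?E = "(edges (triangle_ray S))\<^sup>*"
  have "(0, n) \<in> ?E \<and> (n, 0) \<in> ?E" for n
  proof (induction n)
    case (Suc n)
    moreover have "(n, Suc n) \<in> ?E" "(Suc n, n) \<in> ?E"
      by (auto simp: edges_triangle_ray)
    ultimately show ?case by (meson rtrancl_trans)
  qed simp
  then have "(m, n) \<in> ?E" for m n by (meson rtrancl_trans)
  then show ?thesis by (auto simp: connected_graph_def)
qed

text \<open>The vertex \<open>0\<close> is the only leaf. An isomorphism that is the identity on \<open>{..n}\<close> must send
  \<open>n + 1\<close> to \<open>n + 1\<close>, or to \<open>n + 2\<close> when \<open>n\<close> starts a triangle; the latter is impossible because
  the middle vertex of a triangle has no neighbours outside it.\<close>

lemma triangle_ray_rigid:
  assumes f: "graph_isomorphism (triangle_ray S) (triangle_ray T) f"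
  shows "f n = n" "S = T"
proof -
  let ?E = "\<lambda>S m n. (m, n) \<in> edges (triangle_ray S)"
  have bij: "bij f" and edge: "?E S m n \<longleftrightarrow> ?E T (f m) (f n)" for m n
    using f by (auto simp: graph_isomorphism_def)
  have inj: "f m = f n \<longleftrightarrow> m = n" for m n
    using bij by (metis bij_pointE)
  have surj: "\<exists>m. f m = n" for n
    using bij by (metis bij_pointE)
  have f0: "f 0 = 0"
  proof (rule ccontr)
    assume "f 0 \<noteq> 0"
    then have "?E T (f 0) (f 0 - 1)" "?E T (f 0) (Suc (f 0))"
      by (auto simp: edges_triangle_ray)
    moreover obtain a b where ab: "f a = f 0 - 1" "f b = Suc (f 0)" using surj by metis
    ultimately have "?E S 0 a" "?E S 0 b" using edge by simp_all
    then have "a = 1" "b = 1" by (auto simp: edges_triangle_ray)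
    with ab show False by simp
  qed
  have id: "\<forall>k\<le>n. f k = k" for n
  proof (induction n)
    case (Suc n)
    then have fn: "f n = n" by simp
    have "?E T n (f (Suc n))" using edge[of n "Suc n"] fn by (simp add: edges_triangle_ray)
    \<comment> \<open>The values up to \<open>n\<close> are already taken by the fixed points
      \<open>0, ..., n\<close>.\<close>
    moreover have "f (Suc n) > n"
    proof (rule ccontr)
      assume "\<not> f (Suc n) > n"
      then have "f (f (Suc n)) = f (Suc n)" using Suc by simp
      then show False using inj \<open>\<not> f (Suc n) > n\<close> by simp
    qed
    ultimately consider "f (Suc n) = Suc n" | i where "n = 3 * i + 1" "f (Suc n) = 3 * i + 3"
      by (auto simp: edges_triangle_ray)
    then have "f (Suc n) = Suc n"
    proof cases
      case (2 i)
      \<comment> \<open>Here \<open>Suc n = 3 * i + 2\<close>, whose only possible neighbours are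
        \<open>n\<close> and \<open>3 * i + 3\<close>. Both \<open>a\<close> and \<open>b\<close>
        must be among them, and neither is \<open>n\<close> because \<open>n\<close> is fixed; so
        \<open>a = b\<close>, although their images differ.\<close>
      obtain a b where ab: "f a = 3 * i + 2" "f b = 3 * i + 4" using surj by metis
      have "?E T (f (Suc n)) (f a)" "?E T (f (Suc n)) (f b)"
        using 2 ab by (simp_all add: edges_triangle_ray)
      then have "?E S (3 * i + 2) a" "?E S (3 * i + 2) b" using edge 2 by simp_all
      moreover have "x = 3 * i + 1 \<or> x = 3 * i + 3" if "?E S (3 * i + 2) x" for x
      proof -
        have "3 * i + 2 \<noteq> 3 * k + 1" "3 * i + 2 \<noteq> 3 * k + 3" for k :: nat
          by presburger+
        then show ?thesis using that unfolding edges_triangle_ray by auto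
      qed
      ultimately have "a = 3 * i + 1 \<or> a = 3 * i + 3" "b = 3 * i + 1 \<or> b = 3 * i + 3" by blast+
      then show ?thesis using ab fn 2 by auto
    qed
    then show ?case using Suc by (auto simp: le_Suc_eq)
  qed (simp add: f0)
  then show "f n = n" by blast
  \<comment> \<open>The ends differ by 2, so this is never an edge of the path and the coded set can
    be read off.\<close>
  have tri: "?E S (3 * i + 1) (3 * i + 3) \<longleftrightarrow> i \<in> S" for S i
    unfolding edges_triangle_ray by auto
  have "?E S m n \<longleftrightarrow> ?E T m n" for m n using edge id by (metis order_refl)
  then show "S = T" using tri by blast
qed

section \<open>Disjoint sums with a ray\<close>

definition sum_graph :: "'a ugraph \<Rightarrow> 'b ugraph \<Rightarrow> ('a + 'b) ugraph" where
  "sum_graph G H = (verts G <+> verts H, map_prod Inl Inl ` edges G \<union> map_prod Inr Inr ` edges H)"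

lemma verts_sum_graph [simp]: "verts (sum_graph G H) = verts G <+> verts H"
  by (simp add: sum_graph_def)

lemma edges_sum_graph [simp]:
  "(Inl u, Inl v) \<in> edges (sum_graph G H) \<longleftrightarrow> (u, v) \<in> edges G"
  "(Inr x, Inr y) \<in> edges (sum_graph G H) \<longleftrightarrow> (x, y) \<in> edges H"
  "(Inl u, Inr y) \<notin> edges (sum_graph G H)"
  "(Inr x, Inl v) \<notin> edges (sum_graph G H)"
  by (auto simp: sum_graph_def)

lemma is_graph_sum:
  assumes "is_graph G" "is_graph H"
  shows "is_graph (sum_graph G H)"
  using assms by (fastforce simp: is_graph_def sum_graph_def irrefl_def sym_def)

lemma sum_graph_rtrancl:
  assumes "connected_graph G" "u \<in> verts G" "v \<in> verts G"
  shows "(Inl u, Inl v) \<in> (edges (sum_graph G H))\<^sup>*" "(Inr u, Inr v) \<in> (edges (sum_graph H G))\<^sup>*"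
proof -
  have "(u, v) \<in> (edges G)\<^sup>*" using assms by (auto simp: connected_graph_def)
  then show "(Inl u, Inl v) \<in> (edges (sum_graph G H))\<^sup>*"
    "(Inr u, Inr v) \<in> (edges (sum_graph H G))\<^sup>*"
    by (induction; auto intro: rtrancl_into_rtrancl)+
qed

lemma sum_graph_rtrancl_isl:
  "(x, y) \<in> (edges (sum_graph G H))\<^sup>* \<Longrightarrow> isl x \<longleftrightarrow> isl y"
  by (induction rule: rtrancl_induct) (auto simp: sum_graph_def)

text \<open>Separate embeddings \<open>i\<close> and \<open>j\<close> also cover an isomorphism that
  moves one summand onto the other; \<open>inv_into UNIV j\<close> removes the tag.\<close>

lemma graph_isomorphism_restrict:
  assumes f: "graph_isomorphism G H f" and b: "bij_betw f (i ` verts A) (j ` verts B)"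
    and inj: "inj i" "inj j"
    and i: "i ` verts A \<subseteq> verts G" "\<And>u v. (i u, i v) \<in> edges G \<longleftrightarrow> (u, v) \<in> edges A"
    and j: "\<And>u v. (j u, j v) \<in> edges H \<longleftrightarrow> (u, v) \<in> edges B"
  shows "graph_isomorphism A B (inv_into UNIV j \<circ> f \<circ> i)"
proof -
  have "bij_betw i (verts A) (i ` verts A)" "bij_betw (inv_into UNIV j) (j ` verts B) (verts B)"
    using inj by (auto simp: bij_betw_def image_inv_f_f intro: inj_on_subset inj_on_inv_into)
  then have "bij_betw (inv_into UNIV j \<circ> f \<circ> i) (verts A) (verts B)"
    using b by (auto intro: bij_betw_trans simp: comp_assoc)
  moreover have "(u, v) \<in> edges A \<longleftrightarrow> ((inv_into UNIV j \<circ> f \<circ> i) u, (inv_into UNIV j \<circ> f \<circ> i) v) \<in> edges B"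
    if uv: "u \<in> verts A" "v \<in> verts A" for u v
  proof -
    obtain x y where "f (i u) = j x" "f (i v) = j y"
      using b uv by (metis (no_types, opaque_lifting) bij_betw_imp_surj_on image_iff)
    moreover have "i u \<in> verts G" "i v \<in> verts G" using i(1) uv by auto
    then have "(u, v) \<in> edges A \<longleftrightarrow> (f (i u), f (i v)) \<in> edges H"
      using f i(2)[of u v] by (auto simp: graph_isomorphism_def)
    ultimately show ?thesis using inj j by simp
  qed
  ultimately show ?thesis by (simp add: graph_isomorphism_def)
qed

text \<open>As \<open>C\<close> and \<open>D\<close> are disjoint, points of \<open>C\<close> can
  only be hit from \<open>A\<close> and points of \<open>D\<close> only from
  \<open>B\<close>.\<close>

lemma bij_betw_Un_split:
  assumes b: "bij_betw f (A \<union> B) (C \<union> D)" and "C \<inter> D = {}" "f ` A \<subseteq> C" "f ` B \<subseteq> D"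
  shows "bij_betw f A C" "bij_betw f B D"
proof -
  have "inj_on f A" "inj_on f B" using b by (auto simp: bij_betw_def inj_on_Un)
  moreover have "f ` A \<union> f ` B = C \<union> D" using b by (auto simp: bij_betw_def)
  ultimately show "bij_betw f A C" "bij_betw f B D" using assms unfolding bij_betw_def by blast+
qed

text \<open>Both summands are connected, so \<open>f\<close> sends each into one summand, and
  surjectivity makes the two targets different. A swap would identify \<open>G\<close> with the ray
  of \<open>T\<close>; hence \<open>f\<close> restricts to an isomorphism of rays, and rigidity
  applies. \<open>S = T\<close> separates the graphs of the family, and the second conclusion
  supplies the fixed points for computing \<open>graph_Aut\<close>.\<close>

lemma sum_triangle_ray_isomorphism:
  assumes G: "is_graph G" "connected_graph G" and ni: "\<not> graph_isomorphic G (triangle_ray T)"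
    and f: "graph_isomorphism (sum_graph G (triangle_ray S)) (sum_graph G (triangle_ray T)) f"
  shows "S = T" "f (Inr n) = Inr n"
proof -
  let ?R = "triangle_ray" and ?V = "Inl ` verts G :: ('a + nat) set"
  let ?N = "range Inr :: ('a + nat) set"
  have b: "bij_betw f (?V \<union> ?N) (?V \<union> ?N)"
    using f by (simp add: graph_isomorphism_def Plus_def)
  have disj: "?V \<inter> ?N = {}" by auto
  have into: "f x \<in> ?V \<union> ?N" if "x \<in> ?V \<union> ?N" for x
    using b that by (rule bij_betwE[THEN bspec])
  have gr: "is_graph (sum_graph G (?R S))"
    using G(1) is_graph_triangle_ray by (rule is_graph_sum)
  obtain v0 where v0: "v0 \<in> verts G" using G(1) by (auto simp: is_graph_def)
  have cV: "isl (f x) \<longleftrightarrow> isl (f (Inl v0))" if x: "x \<in> ?V" for x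
  proof -
    obtain v where v: "v \<in> verts G" "x = Inl v" using x by auto
    show ?thesis
      using sum_graph_rtrancl_isl[OF graph_isomorphism_rtrancl[OF f gr
          sum_graph_rtrancl(1)[OF G(2) v(1) v0]]] v(2) by simp
  qed
  have cN: "isl (f x) \<longleftrightarrow> isl (f (Inr 0))" if x: "x \<in> ?N" for x
  proof -
    obtain n where "x = Inr n" using x by auto
    then show ?thesis
      using sum_graph_rtrancl_isl[OF graph_isomorphism_rtrancl[OF f gr
          sum_graph_rtrancl(2)[OF connected_triangle_ray, where u = n and v = 0]]] by simp
  qed
  have ex: "\<exists>x\<in>?V \<union> ?N. f x = y" if "y \<in> ?V \<union> ?N" for y
  proof -
    have "y \<in> f ` (?V \<union> ?N)"
      unfolding bij_betw_imp_surj_on[OF b] by (rule that)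
    then show ?thesis by (auto elim!: imageE)
  qed
  have l: "x \<in> ?V \<longleftrightarrow> isl x" "x \<in> ?N \<longleftrightarrow> \<not> isl x" if "x \<in> ?V \<union> ?N" for x
    using that by auto
  \<comment> \<open>Both tags occur among the values of \<open>f\<close>, and the tag of
    \<open>f x\<close> depends only on the summand of \<open>x\<close>.\<close>
  have one: "isl (f (Inl v0)) \<noteq> isl (f (Inr 0))"
  proof -
    obtain x y where "x \<in> ?V \<union> ?N" "f x = Inl v0" "y \<in> ?V \<union> ?N" "f y = Inr 0"
      using ex[of "Inl v0"] ex[of "Inr 0"] v0 by blast
    then show ?thesis using cV[of x] cN[of x] cV[of y] cN[of y] by auto
  qed
  have fV: "f x \<in> ?V \<longleftrightarrow> isl (f (Inl v0))" "f x \<in> ?N \<longleftrightarrow> \<not> isl (f (Inl v0))" if "x \<in> ?V" for x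
    using l[OF into[OF UnI1[OF that]]] unfolding cV[OF that] .
  have fN: "f x \<in> ?V \<longleftrightarrow> isl (f (Inr 0))" "f x \<in> ?N \<longleftrightarrow> \<not> isl (f (Inr 0))" if "x \<in> ?N" for x
    using l[OF into[OF UnI2[OF that]]] unfolding cN[OF that] .
  have "isl (f (Inl v0))"
  proof (rule ccontr)
    assume "\<not> isl (f (Inl v0))"
    then have "f ` ?V \<subseteq> ?N" "f ` ?N \<subseteq> ?V"
      using one by (intro image_subsetI; simp only: fV fN simp_thms)+
    then have "bij_betw f ?V (Inr ` verts (?R T))"
      using bij_betw_Un_split(1)[of f ?V ?N ?N ?V] b disj by (simp add: Un_commute Int_commute)
    then have "graph_isomorphism G (?R T) (inv_into UNIV Inr \<circ> f \<circ> Inl)"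
      by (rule graph_isomorphism_restrict[OF f]) auto
    then show False using ni by (auto simp: graph_isomorphic_def)
  qed
  then have "f ` ?V \<subseteq> ?V" "f ` ?N \<subseteq> ?N"
    using one by (intro image_subsetI; simp only: fV fN simp_thms)+
  then have bN: "bij_betw f ?N ?N" by (rule bij_betw_Un_split(2)[OF b disj])
  then have "bij_betw f (Inr ` verts (?R S)) (Inr ` verts (?R T))" by simp
  then have r: "graph_isomorphism (?R S) (?R T) (inv_into UNIV Inr \<circ> f \<circ> Inr)"
    by (rule graph_isomorphism_restrict[OF f]) auto
  show "S = T" by (rule triangle_ray_rigid(2)[OF r])
  obtain m where "f (Inr n) = Inr m" using bij_betwE[OF bN] by blast
  then show "f (Inr n) = Inr n" using triangle_ray_rigid(1)[OF r, of n] by simp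
qed

lemma graph_Aut_sum_triangle_ray:
  assumes "is_graph G" "connected_graph G" "\<not> graph_isomorphic G (triangle_ray S)"
  shows "graph_Aut (sum_graph G (triangle_ray S)) \<cong> graph_Aut G"
  by (rule graph_Aut_iso_of_embedding[where h = Inl])
    (use sum_triangle_ray_isomorphism(2)[OF assms] in auto)

text \<open>A ray vertex far beyond \<open>A\<close> has no neighbour in \<open>A\<close>. Ray
  neighbours differ by at most 2, so \<open>N + 3\<close> is distinct from, and not adjacent to,
  every ray vertex up to \<open>N\<close>; vertices of \<open>G\<close> are never adjacent to the
  ray.\<close>

lemma algebraically_closed_complement_sum_triangle_ray:
  "algebraically_closed (complement_graph (sum_graph G (triangle_ray S)))"
  unfolding algebraically_closed_def
proof (intro allI impI)
  fix A assume A: "finite A \<and> A \<subseteq> verts (complement_graph (sum_graph G (triangle_ray S)))"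
  then have "finite (Inr -` A)" by (simp add: finite_vimageI)
  then obtain N where N: "\<And>n. Inr n \<in> A \<Longrightarrow> n \<le> N"
    by (metis finite_nat_set_iff_bounded_le vimageI)
  have "(Inr (N + 3), a) \<in> edges (complement_graph (sum_graph G (triangle_ray S)))" if "a \<in> A" for a
    using that A N by (cases a) (force simp: edges_complement_graph edges_triangle_ray)+
  then show "\<exists>v\<in>verts (complement_graph (sum_graph G (triangle_ray S))).
      \<forall>a\<in>A. (v, a) \<in> edges (complement_graph (sum_graph G (triangle_ray S)))"
    by (intro bexI[of _ "Inr (N + 3)"]) auto
qed

section \<open>Assembly of the family\<close>

theorem theorem3p4:
  fixes \<Gamma> :: "'a ugraph"
  assumes "countable_graph \<Gamma>"
  shows "\<exists>\<F> :: nat ugraph set.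
           \<F> \<approx> Pow (UNIV :: nat set) \<and>
           pairwise (\<lambda>G H. \<not> graph_isomorphic G H) \<F> \<and>
           (\<forall>G\<in>\<F>. countable_graph G \<and> algebraically_closed G \<and>
                  graph_Aut G \<cong> graph_Aut \<Gamma>)"
proof -
  have \<Gamma>: "is_graph \<Gamma>" "countable (verts \<Gamma>)" using assms by (auto simp: countable_graph_def)
  \<comment> \<open>\<open>G\<close> is \<Gamma> or its complement, whichever is connected.\<close>
  obtain G :: "'a ugraph" where G: "is_graph G" "connected_graph G" "countable (verts G)"
    and AutG: "graph_Aut G = graph_Aut \<Gamma>"
    using connected_or_complement_connected[OF \<Gamma>(1)] \<Gamma> is_graph_complement[OF \<Gamma>(1)]
      graph_Aut_complement[OF \<Gamma>(1)] verts_complement_graph[of \<Gamma>] by metis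
  \<comment> \<open>At most one ray is isomorphic to \<open>G\<close>; prescribing whether \<open>0 \<in> S\<close> avoids it.\<close>
  obtain b where b: "\<And>S. 0 \<in> S \<longleftrightarrow> b \<Longrightarrow> \<not> graph_isomorphic G (triangle_ray S)"
  proof (cases "\<exists>S. graph_isomorphic G (triangle_ray S)")
    case True
    then obtain S0 where S0: "graph_isomorphic G (triangle_ray S0)" by blast
    have "S = S0" if "graph_isomorphic G (triangle_ray S)" for S
      using graph_isomorphic_trans[OF graph_isomorphic_sym[OF that] S0] triangle_ray_rigid(2)
      by (auto simp: graph_isomorphic_def)
    then show ?thesis using that[of "0 \<notin> S0"] by blast
  next
    case False
    then show ?thesis using that by blast
  qed
  \<comment> \<open>Shifting by \<open>Suc\<close> frees membership of \<open>0\<close>, which is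
    set by \<open>b\<close>, and keeps the coding injective.\<close>
  define P where "P S = Suc ` S \<union> (if b then {0} else {})" for S
  have ni: "\<not> graph_isomorphic G (triangle_ray (P S))" for S
    by (rule b) (auto simp: P_def)
  have injP: "S = T" if "P S = P T" for S T
  proof -
    have "n \<in> S \<longleftrightarrow> Suc n \<in> P S" for n S by (auto simp: P_def)
    then show ?thesis using that by blast
  qed
  define H where "H S = sum_graph G (triangle_ray (P S))" for S
  have H: "is_graph (H S)" "countable (verts (H S))" for S
    using G is_graph_sum[OF G(1) is_graph_triangle_ray] by (simp_all add: H_def)
  have cH: "is_graph (complement_graph (H S))" for S
    using H(1) by (rule is_graph_complement)
  \<comment> \<open>The vertices have type \<open>'a + nat\<close>; countability allows relabelling
    them by natural numbers.\<close>
  define h where "h S = to_nat_on (verts (H S))" for S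
  define K where "K S = image_graph (h S) (complement_graph (H S))" for S
  have injh: "inj_on (h S) (verts (complement_graph (H S)))" for S
    using H(2) by (simp add: h_def inj_on_to_nat_on)
  have iso: "graph_isomorphism (complement_graph (H S)) (K S) (h S)" for S
    unfolding K_def using cH injh by (rule graph_isomorphism_image)
  \<comment> \<open>Undo the relabelling and the complement, then compare the sums.\<close>
  have noniso: "S = T" if "graph_isomorphic (K S) (K T)" for S T
  proof -
    have "graph_isomorphic (complement_graph (H S)) (complement_graph (H T))"
      using that iso by (meson graph_isomorphic_def graph_isomorphic_sym graph_isomorphic_trans)
    then obtain f where "graph_isomorphism (H S) (H T) f"
      using H(1) by (auto simp: graph_isomorphic_def graph_isomorphism_complement)
    then have "P S = P T"
      unfolding H_def by (rule sum_triangle_ray_isomorphism(1)[OF G(1,2) ni])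
    then show "S = T" by (rule injP)
  qed
  \<comment> \<open>Equal graphs are isomorphic, so \<open>K\<close> is injective on all sets of
    natural numbers and its range has the size of the power set.\<close>
  have "inj K" using noniso graph_isomorphic_refl by (metis injI)
  then have "range K \<approx> Pow (UNIV :: nat set)"
    by (simp add: inj_on_image_eqpoll_self)
  moreover have "pairwise (\<lambda>G H. \<not> graph_isomorphic G H) (range K)"
    using noniso by (auto simp: pairwise_def)
  moreover have "countable_graph (K S)" for S
    using is_graph_image[OF cH injh] by (simp add: countable_graph_def K_def)
  moreover have "algebraically_closed (K S)" for S
    using iso algebraically_closed_complement_sum_triangle_ray
    unfolding H_def by (rule algebraically_closed_isomorphic)
  moreover have "graph_Aut (K S) \<cong> graph_Aut \<Gamma>" for S
  proof -
    have "graph_Aut (K S) \<cong> graph_Aut (H S)"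
      using graph_Aut_isomorphic[OF iso] graph_Aut_complement[OF H(1)] by metis
    also have "graph_Aut (H S) \<cong> graph_Aut \<Gamma>"
      unfolding H_def AutG[symmetric] using G(1,2) ni by (rule graph_Aut_sum_triangle_ray)
    finally (iso_trans) show ?thesis .
  qed
  ultimately show ?thesis by blast
qed

end
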